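(* For every monotone and convex function $f:[0,4\pi]\to\mathbb{R}$ and all positive integers $m$ and $n$, $$\int_{0}^{2\pi}\int_{0}^{2\pi}f(s+t)\,\sin(ms)\,\sin(nt)\,ds\,dt\geq 0.$$
   Context: Monotone means either increasing or decreasing (in the weak sense) on $[0,4\pi]$. *)

theory Defs
  imports "HOL-Analysis.Analysis"
begin

end

theory Submission imports Defs begin

text \<open>
  The double integral is linear in \<open>f\<close> and vanishes for constant \<open>f\<close>. A convex \<open>f\<close> is the pointwise
  limit on \<open>[0, 4 \<pi>]\<close>, end points included, of its piecewise linear interpolants, so by dominated
  convergence and Abel summation it suffices to treat \<open>f u = max 0 (u - a)\<close>. For \<open>a \<le> 2 \<pi>\<close> and
  \<open>m \<noteq> n\<close> the integral is then a positive multiple of \<open>(h (m a) - h (n a)) / (n - m)\<close> with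
  \<open>h x = (x - sin x) / x ^ 3\<close>, and the case \<open>a \<ge> 2 \<pi>\<close> follows by the reflection
  \<open>a \<mapsto> 4 \<pi> - a\<close>. So everything rests on \<open>h\<close> being decreasing, which is the Cusa--Huygens
  inequality \<open>3 sin x \<le> x (2 + cos x)\<close>; the same inequality settles the case \<open>m = n\<close>.
\<close>

section \<open>The Cusa--Huygens inequality and its consequence for
  \<open>(x - sin x) / x ^ 3\<close>\<close>

text \<open>Up to \<open>2 * pi\<close> the difference of the two sides has a derivative that
  factors through the half angle into nonnegative terms. Beyond that point \<open>3 \<le> x\<close>
  and \<open>1 \<le> 2 + cos x\<close> suffice.\<close>

lemma cusa_huygens:
  fixes x :: real
  assumes "0 \<le> x"
  shows "3 * sin x \<le> x * (2 + cos x)"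
proof (cases "x \<le> 2 * pi")
  case True
  have 1: "y * cos y \<le> sin y" if "0 \<le> y" "y \<le> pi" for y :: real
  proof -
    have "sin 0 - 0 * cos 0 \<le> sin y - y * cos y"
    proof (rule DERIV_nonneg_imp_nondecreasing[OF that(1)])
      fix z assume z: "0 \<le> z" "z \<le> y"
      have "((\<lambda>y. sin y - y * cos y) has_real_derivative z * sin z) (at z)"
        by (auto intro!: derivative_eq_intros)
      moreover have "0 \<le> z * sin z"
        using z that by (intro mult_nonneg_nonneg sin_ge_zero) auto
      ultimately show "\<exists>D. ((\<lambda>y. sin y - y * cos y) has_real_derivative D) (at z) \<and> 0 \<le> D"
        by blast
    qed
    then show ?thesis by simp
  qed
  have "0 * (2 + cos 0) - 3 * sin 0 \<le> x * (2 + cos x) - 3 * sin x"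
  proof (rule DERIV_nonneg_imp_nondecreasing[OF assms])
    fix z assume z: "0 \<le> z" "z \<le> x"
    \<comment> \<open>The bound \<open>z \<le> 2 * pi\<close> puts the half angle in
      \<open>[0, pi]\<close>, where both \<open>sin y\<close> and \<open>sin y - y * cos y\<close>
      are nonnegative.\<close>
    define y where "y = z / 2"
    have "((\<lambda>x. x * (2 + cos x) - 3 * sin x) has_real_derivative 2 - 2 * cos z - z * sin z) (at z)"
      by (auto intro!: derivative_eq_intros simp: algebra_simps)
    moreover have "2 - 2 * cos z - z * sin z = 4 * sin y * (sin y - y * cos y)"
      using cos_double_sin[of y] sin_double[of y] by (simp add: y_def power2_eq_square algebra_simps)
    moreover have "0 \<le> 4 * sin y * (sin y - y * cos y)"
      using z True 1[of y] by (intro mult_nonneg_nonneg sin_ge_zero) (auto simp: y_def)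
    ultimately show "\<exists>D. ((\<lambda>x. x * (2 + cos x) - 3 * sin x) has_real_derivative D) (at z) \<and> 0 \<le> D"
      by metis
  qed
  then show ?thesis by simp
next
  case False
  have "3 * sin x \<le> 3" by simp
  also have "3 \<le> x" using False pi_gt3 by simp
  also have "x \<le> x * (2 + cos x)"
    using mult_left_mono[of 1 "2 + cos x" x] assms cos_ge_minus_one[of x] by simp
  finally show ?thesis .
qed

text \<open>The numerator of the derivative, after cancelling \<open>z ^ 2\<close>, is exactly the
  Cusa--Huygens difference.\<close>

lemma id_minus_sin_div_cube_antimono:
  fixes x y :: real
  assumes "0 < x" "x \<le> y"
  shows "(y - sin y) / y ^ 3 \<le> (x - sin x) / x ^ 3"
proof (rule DERIV_nonpos_imp_nonincreasing[OF assms(2)])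
  fix z assume z: "x \<le> z" "z \<le> y"
  then have "z > 0" using assms by simp
  then have "((\<lambda>x. (x - sin x) / x ^ 3) has_real_derivative (3 * sin z - z * (2 + cos z)) / z ^ 4) (at z)"
    by (auto intro!: derivative_eq_intros simp: divide_simps power2_eq_square power3_eq_cube power4_eq_xxxx)
       (auto simp: algebra_simps)
  moreover have "(3 * sin z - z * (2 + cos z)) / z ^ 4 \<le> 0"
    using cusa_huygens[of z] \<open>z > 0\<close> by (simp add: divide_nonpos_pos)
  ultimately show "\<exists>D. ((\<lambda>x. (x - sin x) / x ^ 3) has_real_derivative D) (at z) \<and> D \<le> 0"
    by blast
qed

section \<open>The Peano kernel and its sign\<close>

text \<open>The convolution of \<open>sin (m x)\<close> and \<open>sin (n x)\<close> on \<open>[0, a]\<close>, in closed form.\<close>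
definition sin_conv :: "nat \<Rightarrow> nat \<Rightarrow> real \<Rightarrow> real" where
  "sin_conv m n a = (if m = n then sin (m * a) / (2 * m) - a * cos (m * a) / 2
     else (m * sin (n * a) - n * sin (m * a)) / (real m ^ 2 - real n ^ 2))"

text \<open>The second antiderivative of \<open>sin_conv m n\<close> that vanishes together with its derivative at \<open>0\<close>.\<close>
definition peano_kernel :: "nat \<Rightarrow> nat \<Rightarrow> real \<Rightarrow> real" where
  "peano_kernel m n a = (a / n - sin (n * a) / real n ^ 2) / m - sin_conv m n a / real m ^ 2"

lemma peano_kernel_0 [simp]: "peano_kernel m n 0 = 0"
  by (simp add: peano_kernel_def sin_conv_def)

text \<open>This form separates \<open>m\<close> from \<open>n\<close>: the bracket compares one and
  the same expression at the two frequencies.\<close>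

lemma peano_kernel_neq:
  assumes "m > 0" "n > 0" "m \<noteq> n"
  shows "peano_kernel m n a = real m * real n / (real n ^ 2 - real m ^ 2) *
    ((m * a - sin (m * a)) / real m ^ 3 - (n * a - sin (n * a)) / real n ^ 3)"
proof -
  have "real n ^ 2 - real m ^ 2 \<noteq> 0" using assms by simp
  moreover have "real m ^ 2 - real n ^ 2 = - (real n ^ 2 - real m ^ 2)" by simp
  ultimately show ?thesis using assms
    unfolding peano_kernel_def sin_conv_def
    by (simp only: if_False, simp add: divide_simps del: minus_diff_eq)
       (simp add: algebra_simps power2_eq_square power3_eq_cube)
qed

lemma peano_kernel_nonneg:
  assumes m: "m > 0" and n: "n > 0" and "0 \<le> a"
  shows "0 \<le> peano_kernel m n a"
proof (cases "a = 0")
  case False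
  with assms have a: "a > 0" by simp
  \<comment> \<open>Pulling out \<open>a ^ 3\<close> turns both terms of the bracket into values of
    \<open>(x - sin x) / x ^ 3\<close>, at \<open>m * a\<close> and \<open>n * a\<close>.\<close>
  have cube: "(k * a - sin (k * a)) / real k ^ 3 = a ^ 3 * ((k * a - sin (k * a)) / (k * a) ^ 3)" for k :: nat
    using a by (simp add: power_mult_distrib)
  consider "m = n" | "m < n" | "n < m" by linarith
  then show ?thesis
  proof cases
    case 1
    have "peano_kernel m m a = (m * a * (2 + cos (m * a)) - 3 * sin (m * a)) / (2 * real m ^ 3)"
      using m by (simp add: peano_kernel_def sin_conv_def field_simps power2_eq_square power3_eq_cube)
    then show ?thesis
      using cusa_huygens[of "m * a"] a 1 by simp
  next
    case 2
    have "(n * a - sin (n * a)) / (n * a) ^ 3 \<le> (m * a - sin (m * a)) / (m * a) ^ 3"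
      using 2 a m by (intro id_minus_sin_div_cube_antimono) auto
    then have "0 \<le> (m * a - sin (m * a)) / real m ^ 3 - (n * a - sin (n * a)) / real n ^ 3"
      unfolding cube diff_ge_0_iff_ge using a by (intro mult_left_mono) auto
    moreover have "0 \<le> real m * real n / (real n ^ 2 - real m ^ 2)" using 2 by simp
    ultimately show ?thesis
      unfolding peano_kernel_neq[OF m n less_imp_neq[OF 2]] by (rule mult_nonneg_nonneg[rotated])
  next
    case 3
    have "(m * a - sin (m * a)) / (m * a) ^ 3 \<le> (n * a - sin (n * a)) / (n * a) ^ 3"
      using 3 a n by (intro id_minus_sin_div_cube_antimono) auto
    then have "(m * a - sin (m * a)) / real m ^ 3 - (n * a - sin (n * a)) / real n ^ 3 \<le> 0"
      unfolding cube diff_le_0_iff_le using a by (intro mult_left_mono) auto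
    moreover have "real m * real n / (real n ^ 2 - real m ^ 2) \<le> 0"
      using 3 by (intro divide_nonneg_nonpos) auto
    ultimately show ?thesis
      unfolding peano_kernel_neq[OF m n less_imp_neq[OF 3, symmetric]] by (rule mult_nonpos_nonpos[rotated])
  qed
qed simp

section \<open>Explicit integrals, up to the double integral of a hinge function\<close>

lemma sin_nat_2pi_minus [simp]: "sin (real m * (2 * pi - x)) = - sin (real m * x)"
  and cos_nat_2pi_minus [simp]: "cos (real m * (2 * pi - x)) = cos (real m * x)"
proof -
  have *: "real m * (2 * pi - x) = 2 * real m * pi - real m * x"
    by (simp add: algebra_simps)
  show "sin (real m * (2 * pi - x)) = - sin (real m * x)"
    unfolding * sin_diff by simp
  show "cos (real m * (2 * pi - x)) = cos (real m * x)"
    unfolding * cos_diff by simp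
qed

lemma sin_nat_2pi [simp]: "sin (real m * (2 * pi)) = 0"
  and cos_nat_2pi [simp]: "cos (real m * (2 * pi)) = 1"
  using sin_nat_2pi_minus[of m 0] cos_nat_2pi_minus[of m 0] by auto

text \<open>An antiderivative in \<open>t\<close> of the convolution integrand; equal frequencies
  need a separate branch with a secular term \<open>t * cos (m * a)\<close>.\<close>

definition sin_sin_primitive :: "nat \<Rightarrow> nat \<Rightarrow> real \<Rightarrow> real \<Rightarrow> real" where
  "sin_sin_primitive m n a t =
     (if m = n then - sin (m * (a - 2 * t)) / (4 * m) - t * cos (m * a) / 2
      else (n * sin (m * (a - t)) * cos (n * t) + m * cos (m * (a - t)) * sin (n * t))
             / (real m ^ 2 - real n ^ 2))"

lemma sin_sin_primitive:
  assumes "m > 0"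
  shows "(sin_sin_primitive m n a has_real_derivative sin (m * (a - t)) * sin (n * t)) (at t within S)"
proof (cases "m = n")
  case True
  have "cos (m * (a - 2 * t)) = cos (m * (a - t)) * cos (m * t) + sin (m * (a - t)) * sin (m * t)"
    using cos_diff[of "m * (a - t)" "m * t"] by (simp add: algebra_simps)
  moreover have "cos (m * a) = cos (m * (a - t)) * cos (m * t) - sin (m * (a - t)) * sin (m * t)"
    using cos_add[of "m * (a - t)" "m * t"] by (simp add: algebra_simps)
  ultimately have "(cos (m * (a - 2 * t)) - cos (m * a)) / 2 = sin (m * (a - t)) * sin (m * t)"
    by simp
  moreover have "sin_sin_primitive m n a = (\<lambda>t. - sin (m * (a - 2 * t)) / (4 * m) - t * cos (m * a) / 2)"
    using True by (auto simp: sin_sin_primitive_def)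
  moreover have "((\<lambda>t. - sin (m * (a - 2 * t)) / (4 * m) - t * cos (m * a) / 2) has_real_derivative
      (cos (m * (a - 2 * t)) - cos (m * a)) / 2) (at t within S)"
    using assms by (auto intro!: derivative_eq_intros simp: field_simps)
  ultimately show ?thesis using True by simp
next
  case False
  then have nz: "real m ^ 2 - real n ^ 2 \<noteq> 0" by simp
  have "((\<lambda>t. (n * sin (m * (a - t)) * cos (n * t) + m * cos (m * (a - t)) * sin (n * t))
       / (real m ^ 2 - real n ^ 2)) has_real_derivative
       (real m ^ 2 - real n ^ 2) * (sin (m * (a - t)) * sin (n * t)) / (real m ^ 2 - real n ^ 2)) (at t within S)"
    by (rule DERIV_cdivide) (auto intro!: derivative_eq_intros simp: algebra_simps power2_eq_square)
  then show ?thesis using False nz by (simp add: sin_sin_primitive_def[abs_def])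
qed

lemma sin_conv_has_integral:
  fixes a :: real
  assumes "m > 0" "0 \<le> a"
  shows "((\<lambda>t. sin (m * (a - t)) * sin (n * t)) has_integral sin_conv m n a) {0..a}"
proof -
  have "((\<lambda>t. sin (m * (a - t)) * sin (n * t)) has_integral
      sin_sin_primitive m n a a - sin_sin_primitive m n a 0) {0..a}"
    using assms sin_sin_primitive
    by (intro fundamental_theorem_of_calculus) (auto simp: has_real_derivative_iff_has_vector_derivative[symmetric])
  moreover have "sin_sin_primitive m n a a - sin_sin_primitive m n a 0 = sin_conv m n a"
    using assms by (auto simp: sin_sin_primitive_def sin_conv_def diff_divide_distrib)
  ultimately show ?thesis by simp
qed

text \<open>The factor \<open>x / m - sin (m * x) / m ^ 2\<close> is the double antiderivative of
  \<open>sin (m * x)\<close> from \<open>0\<close>. Its linear part is integrated by parts, its sine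
  part is \<open>sin_conv\<close>.\<close>

lemma peano_kernel_has_integral:
  fixes a :: real
  assumes "m > 0" "n > 0" "0 \<le> a"
  shows "((\<lambda>t. ((a - t) / m - sin (m * (a - t)) / real m ^ 2) * sin (n * t)) has_integral peano_kernel m n a) {0..a}"
proof -
  let ?F = "\<lambda>t::real. - (a - t) * cos (n * t) / n - sin (n * t) / real n ^ 2"
  have "((\<lambda>t. (a - t) * sin (n * t)) has_integral ?F a - ?F 0) {0..a}"
    using assms
    by (intro fundamental_theorem_of_calculus)
       (auto simp: has_real_derivative_iff_has_vector_derivative[symmetric] field_simps power2_eq_square
             intro!: derivative_eq_intros)
  from has_integral_diff[OF has_integral_divide[OF this, of m]
      has_integral_divide[OF sin_conv_has_integral[OF assms(1,3), of n], of "real m ^ 2"]]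
  show ?thesis by (simp add: peano_kernel_def algebra_simps diff_divide_distrib)
qed

text \<open>This serves as the inner integral of a hinge function, with \<open>b = a - t\<close>.
  The branches record whether the kink lies left of, inside or right of the interval, and
  neighbouring formulas agree at \<open>0\<close> and \<open>2 * pi\<close>.\<close>

lemma pos_part_sin_integral:
  fixes b :: real and m :: nat
  assumes m: "m > 0"
  shows "((\<lambda>s. max 0 (s - b) * sin (m * s)) has_integral
    (if b \<le> 0 then - 2 * pi / m else if b \<le> 2 * pi then - (2 * pi - b) / m - sin (m * b) / real m ^ 2 else 0)) {0..2 * pi}"
proof -
  let ?F = "\<lambda>s::real. - (s - b) * cos (m * s) / m + sin (m * s) / real m ^ 2"
  have F: "((\<lambda>s. (s - b) * sin (m * s)) has_integral ?F y - ?F x) {x..y}" if "x \<le> y" for x y :: real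
    using m that
    by (intro fundamental_theorem_of_calculus)
       (auto simp: has_real_derivative_iff_has_vector_derivative[symmetric] field_simps power2_eq_square
             intro!: derivative_eq_intros)
  consider "b \<le> 0" | "0 < b" "b \<le> 2 * pi" | "2 * pi < b" by linarith
  then show ?thesis
  proof cases
    case 1
    have "((\<lambda>s. max 0 (s - b) * sin (m * s)) has_integral ?F (2 * pi) - ?F 0) {0..2 * pi}"
      using F[of 0 "2 * pi"] 1 by (rule_tac has_integral_eq[rotated]) auto
    then show ?thesis using 1 m by (simp add: diff_divide_distrib)
  next
    case 2
    have "((\<lambda>s. max 0 (s - b) * sin (m * s)) has_integral 0) {0..b}"
      by (rule has_integral_eq[of _ "\<lambda>_. 0"]) auto
    moreover have "((\<lambda>s. max 0 (s - b) * sin (m * s)) has_integral ?F (2 * pi) - ?F b) {b..2 * pi}"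
      using F[of b "2 * pi"] 2 by (rule_tac has_integral_eq[rotated]) auto
    ultimately have "((\<lambda>s. max 0 (s - b) * sin (m * s)) has_integral 0 + (?F (2 * pi) - ?F b)) {0..2 * pi}"
      using 2 by (intro has_integral_combine) auto
    then show ?thesis using 2 m by simp
  next
    case 3
    have "((\<lambda>s. max 0 (s - b) * sin (m * s)) has_integral 0) {0..2 * pi}"
      by (rule has_integral_eq[of _ "\<lambda>_. 0"]) (use 3 in auto)
    moreover have "\<not> b \<le> 0" using 3 pi_gt_zero by linarith
    ultimately show ?thesis using 3 by simp
  qed
qed

definition sin_pairing :: "nat \<Rightarrow> nat \<Rightarrow> (real \<Rightarrow> real) \<Rightarrow> real" where
  "sin_pairing m n f = integral {0..2 * pi} (\<lambda>t. integral {0..2 * pi}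
     (\<lambda>s. f (s + t) * sin (real m * s) * sin (real n * t)))"

lemma sin_nat_integral: "((\<lambda>t. sin (real n * t)) has_integral 0) {0..2 * pi}"
proof (cases "n = 0")
  case False
  have "((\<lambda>t. sin (real n * t)) has_integral - cos (n * (2 * pi)) / n - - cos (n * (0::real)) / n) {0..2 * pi}"
    using False
    by (intro fundamental_theorem_of_calculus)
       (auto simp: has_real_derivative_iff_has_vector_derivative[symmetric] intro!: derivative_eq_intros)
  then show ?thesis by simp
qed auto

text \<open>Integrating over \<open>s\<close> leaves \<open>g (a - t)\<close> against
  \<open>sin (n * t)\<close>. For \<open>a \<le> 2 * pi\<close> this becomes the kernel integral
  once a constant is added to \<open>g\<close>; larger \<open>a\<close> is reduced to
  \<open>4 * pi - a\<close> by reflecting \<open>t\<close>.\<close>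

lemma sin_pairing_pos_part:
  fixes a :: real
  assumes m: "m > 0" and n: "n > 0" and a: "0 \<le> a" "a \<le> 4 * pi"
  shows "sin_pairing m n (\<lambda>u. max 0 (u - a)) = peano_kernel m n (min a (4 * pi - a))"
proof -
  define g where "g b = (if b \<le> 0 then - 2 * pi / m
     else if b \<le> 2 * pi then - (2 * pi - b) / m - sin (m * b) / real m ^ 2 else 0)" for b :: real
  have inner: "integral {0..2 * pi} (\<lambda>s. max 0 (s + t - a) * sin (m * s) * sin (n * t)) = g (a - t) * sin (n * t)"
    for t :: real
  proof -
    have "((\<lambda>s. max 0 (s - (a - t)) * sin (m * s)) has_integral g (a - t)) {0..2 * pi}"
      unfolding g_def by (rule pos_part_sin_integral[OF m])
    from has_integral_mult_left[OF this, of "sin (n * t)"] show ?thesis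
      by (intro integral_unique) (simp add: algebra_simps)
  qed
  have "((\<lambda>t. g (a - t) * sin (n * t)) has_integral peano_kernel m n (min a (4 * pi - a))) {0..2 * pi}"
  proof (cases "a \<le> 2 * pi")
    case True
    \<comment> \<open>Adding \<open>2 * pi / m\<close> makes the first factor vanish for
      \<open>t \<ge> a\<close>; the constant itself integrates to \<open>0\<close> against
      \<open>sin (n * t)\<close> and is subtracted again below.\<close>
    have "((\<lambda>t. (g (a - t) + 2 * pi / m) * sin (n * t)) has_integral peano_kernel m n a) {0..a}"
      by (rule has_integral_eq[OF _ peano_kernel_has_integral[OF m n a(1)]])
         (use True m in \<open>auto simp: g_def diff_divide_distrib\<close>)
    moreover have "((\<lambda>t. (g (a - t) + 2 * pi / m) * sin (n * t)) has_integral 0) {a..2 * pi}"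
      by (rule has_integral_eq[of _ "\<lambda>_. 0"]) (auto simp: g_def)
    ultimately have "((\<lambda>t. (g (a - t) + 2 * pi / m) * sin (n * t)) has_integral peano_kernel m n a + 0) {0..2 * pi}"
      using True a by (intro has_integral_combine) auto
    from has_integral_diff[OF this has_integral_mult_right[OF sin_nat_integral[of n], of "2 * pi / m"]] True
    show ?thesis by (simp add: algebra_simps)
  next
    case False
    define c where "c = 4 * pi - a"
    have c: "0 \<le> c" "c < 2 * pi" using a False by (auto simp: c_def)
    have "((\<lambda>t. ((c - t) / m - sin (m * (c - t)) / real m ^ 2) * sin (n * t)) has_integral peano_kernel m n c) {0..c}"
      by (rule peano_kernel_has_integral[OF m n c(1)])
    \<comment> \<open>Reflection followed by a shift realises the substitution of
      \<open>2 * pi - t\<close> for \<open>t\<close>.\<close>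
    from has_integral_shift_real_ivl[OF has_integral_reflect_lemma_real[OF this], of "- 2 * pi"]
    have *: "((\<lambda>t. ((c - (2 * pi - t)) / m - sin (m * (c - (2 * pi - t))) / real m ^ 2) * sin (n * (2 * pi - t)))
      has_integral peano_kernel m n c) {2 * pi - c..2 * pi}"
      by simp
    have "((\<lambda>t. g (a - t) * sin (n * t)) has_integral peano_kernel m n c) {2 * pi - c..2 * pi}"
    proof (rule has_integral_eq[OF _ *])
      fix t assume "t \<in> {2 * pi - c..2 * pi}"
      then have t: "0 < a - t" "a - t \<le> 2 * pi" using False by (auto simp: c_def)
      have "c - (2 * pi - t) = 2 * pi - (a - t)" by (simp add: c_def)
      \<comment> \<open>Both factors change sign under the substitution, so the product keeps its
        sign.\<close>
      then show "((c - (2 * pi - t)) / m - sin (m * (c - (2 * pi - t))) / real m ^ 2) * sin (n * (2 * pi - t))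
        = g (a - t) * sin (n * t)"
        using t by (simp only: g_def sin_nat_2pi_minus) (simp add: algebra_simps diff_divide_distrib add_divide_distrib)
    qed
    moreover have "((\<lambda>t. g (a - t) * sin (n * t)) has_integral 0) {0..2 * pi - c}"
    proof (rule has_integral_eq[of _ "\<lambda>_. 0"])
      fix t assume "t \<in> {0..2 * pi - c}"
      then have "2 * pi \<le> a - t" by (simp add: c_def)
      then have "g (a - t) = 0"
      \<comment> \<open>The boundary value falls under the middle branch of \<open>g\<close>, whose
        formula also gives \<open>0\<close> there.\<close>
      proof (cases "a - t = 2 * pi")
        case True
        have "\<not> 2 * pi \<le> 0" using pi_gt_zero by linarith
        then show ?thesis unfolding True g_def by (simp only: if_False if_True order_refl) simp
      next
        case False
        with \<open>2 * pi \<le> a - t\<close> pi_gt_zero have "\<not> a - t \<le> 0" "\<not> a - t \<le> 2 * pi" by linarith+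
        then show ?thesis by (simp only: g_def if_False)
      qed
      then show "0 = g (a - t) * sin (n * t)" by simp
    qed simp
    ultimately have "((\<lambda>t. g (a - t) * sin (n * t)) has_integral 0 + peano_kernel m n c) {0..2 * pi}"
      using c by (intro has_integral_combine) auto
    then show ?thesis using False by (simp add: c_def min_def)
  qed
  then show ?thesis
    unfolding sin_pairing_def inner by (rule integral_unique)
qed

section \<open>Linearity of the pairing\<close>

text \<open>The inner integrand is continuous, and the inner integral depends continuously on
  \<open>t\<close>. Continuity on the whole line is available for hinge functions and interpolants
  alike.\<close>

lemma sin_pairing_integrable:
  assumes "continuous_on UNIV f"
  shows "(\<lambda>s. f (s + t) * sin (real m * s) * sin (real n * t)) integrable_on {0..2 * pi}"
    and "(\<lambda>t. integral {0..2 * pi} (\<lambda>s. f (s + t) * sin (real m * s) * sin (real n * t)))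
      integrable_on {0..2 * pi}"
proof -
  have f: "continuous_on S (\<lambda>x. f (g x))" if "continuous_on S g" for S :: "'b::topological_space set" and g
    using continuous_on_compose2[OF assms that] by simp
  show "(\<lambda>s. f (s + t) * sin (real m * s) * sin (real n * t)) integrable_on {0..2 * pi}"
    by (intro integrable_continuous_real continuous_intros f)
  have "continuous_on {0..2 * pi} (\<lambda>t. integral (cbox 0 (2 * pi))
      (\<lambda>s. f (s + t) * sin (real m * s) * sin (real n * t)))"
    by (intro integral_continuous_on_param) (auto simp: case_prod_unfold intro!: continuous_intros f)
  then show "(\<lambda>t. integral {0..2 * pi} (\<lambda>s. f (s + t) * sin (real m * s) * sin (real n * t)))
      integrable_on {0..2 * pi}"
    by (intro integrable_continuous_real) simp
qed

lemma sin_pairing_add: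
  assumes "continuous_on UNIV f" "continuous_on UNIV g"
  shows "sin_pairing m n (\<lambda>u. f u + g u) = sin_pairing m n f + sin_pairing m n g"
  using sin_pairing_integrable[OF assms(1), where m = m and n = n]
    sin_pairing_integrable[OF assms(2), where m = m and n = n]
  by (simp add: sin_pairing_def distrib_right integral_add)

lemma sin_pairing_scale: "sin_pairing m n (\<lambda>u. c * f u) = c * sin_pairing m n f"
  by (simp add: sin_pairing_def mult.assoc)

lemma sin_pairing_const: "sin_pairing m n (\<lambda>_. c) = 0"
proof -
  have "integral {0..2 * pi} (\<lambda>s. c * sin (real m * s) * sin (real n * t)) = 0" for t
    using has_integral_mult_right[OF has_integral_mult_left[OF sin_nat_integral[of m], of "sin (real n * t)"], of c]
    by (intro integral_unique) (simp add: mult.assoc)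
  then show ?thesis by (simp only: sin_pairing_def) simp
qed

section \<open>Piecewise linear interpolation\<close>

text \<open>Each difference of two hinges is a ramp that climbs from \<open>0\<close> to
  \<open>h\<close> across one cell and then stays constant; weighted by slopes, the ramps add up to
  the linear interpolant at the nodes \<open>k * h\<close>. Written this way it is visibly a
  combination of hinge functions.\<close>

definition interpolant :: "(real \<Rightarrow> real) \<Rightarrow> real \<Rightarrow> nat \<Rightarrow> real \<Rightarrow> real" where
  "interpolant f h N u = f 0 +
     (\<Sum>k<N. (f (real (Suc k) * h) - f (real k * h)) / h * (max 0 (u - real k * h) - max 0 (u - real (Suc k) * h)))"

lemma interpolant_Suc:
  fixes h u :: real
  shows "interpolant f h (Suc N) u = interpolant f h N u +
     (f (Suc N * h) - f (N * h)) / h * (max 0 (u - N * h) - max 0 (u - Suc N * h))"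
  by (simp add: interpolant_def)

lemma interpolant_0: "0 < h \<Longrightarrow> interpolant f h N 0 = f 0"
  by (simp add: interpolant_def max_absorb1)

lemma interpolant_beyond:
  fixes h u :: real
  assumes "0 < h" "N * h \<le> u"
  shows "interpolant f h N u = f (N * h)"
  using assms(2)
proof (induction N)
  case (Suc N)
  have "N * h \<le> Suc N * h" using assms(1) by simp
  then have "N * h \<le> u" using Suc.prems by linarith
  moreover have "max 0 (u - N * h) - max 0 (u - Suc N * h) = h"
    using calculation Suc.prems by (simp add: max_def algebra_simps)
  ultimately show ?case
    unfolding interpolant_Suc using Suc.IH assms(1) by simp
qed (simp add: interpolant_def)

lemma interpolant_cell:
  fixes h u :: real
  assumes "0 < h" "j < N" "j * h \<le> u" "u \<le> Suc j * h"
  shows "interpolant f h N u = f (j * h) + (f (Suc j * h) - f (j * h)) / h * (u - j * h)"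
  using assms(2)
proof (induction N)
  case (Suc N)
  show ?case
  proof (cases "j = N")
    case True
    then show ?thesis
      using interpolant_beyond[OF assms(1), of N u f] assms
      by (simp add: interpolant_Suc max_def del: of_nat_Suc)
  next
    case False
    with Suc.prems have "j < N" by simp
    then have "Suc j * h \<le> N * h" using assms(1) by (intro mult_right_mono) auto
    with assms(4) have "u \<le> N * h" by simp
    moreover have "N * h \<le> Suc N * h" using assms(1) by simp
    ultimately show ?thesis
      using Suc.IH[OF \<open>j < N\<close>] by (simp add: interpolant_Suc max_absorb1 del: of_nat_Suc)
  qed
qed simp

text \<open>The value at \<open>u\<close> is a convex combination of the values of \<open>f\<close>
  at the two ends of the cell containing \<open>u\<close>. Boundedness and convergence both follow
  from this.\<close>

lemma interpolant_between:
  fixes h u :: real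
  assumes "0 < h" "0 < N" "0 \<le> u" "u \<le> N * h"
  obtains x y l where "x \<in> {0..N * h}" "y \<in> {0..N * h}" "\<bar>x - u\<bar> \<le> h" "\<bar>y - u\<bar> \<le> h"
    "0 \<le> l" "l \<le> 1" "interpolant f h N u = (1 - l) * f x + l * f y"
proof -
  \<comment> \<open>At the right end point the floor would give \<open>N\<close>, one past the last
    cell.\<close>
  define j where "j = (if u = N * h then N - 1 else nat \<lfloor>u / h\<rfloor>)"
  have j: "j < N" "j * h \<le> u" "u \<le> Suc j * h"
  proof -
    have "j < N \<and> j * h \<le> u \<and> u \<le> Suc j * h"
    proof (cases "u = N * h")
      case True
      then have "N = Suc j" using assms(2) by (simp add: j_def)
      then show ?thesis using True assms(1) by simp
    next
      case False
      have "real j = of_int \<lfloor>u / h\<rfloor>" using False assms by (simp add: j_def)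
      then have "real j \<le> u / h" "u / h < real j + 1" by linarith+
      moreover have "u / h < N" using False assms by (simp add: field_simps)
      ultimately have "real j < N" by linarith
      then show ?thesis
        using \<open>real j \<le> u / h\<close> \<open>u / h < real j + 1\<close> assms(1) by (simp add: field_simps)
    qed
    then show "j < N" "j * h \<le> u" "u \<le> Suc j * h" by auto
  qed
  have Suc_j: "Suc j * h \<le> N * h" using j(1) assms(1) by (intro mult_right_mono) auto
  show ?thesis
  proof (rule that[of "j * h" "Suc j * h" "(u - j * h) / h"])
    show "interpolant f h N u = (1 - (u - j * h) / h) * f (j * h) + (u - j * h) / h * f (Suc j * h)"
      unfolding interpolant_cell[OF assms(1) j] using assms(1) by (simp add: field_simps)
  qed (use j Suc_j assms in \<open>auto simp: field_simps abs_le_iff\<close>)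
qed

lemma interpolant_bounded:
  fixes h u :: real
  assumes "0 < h" "0 < N" "0 \<le> u" "u \<le> N * h" "\<And>x. x \<in> {0..N * h} \<Longrightarrow> \<bar>f x\<bar> \<le> M"
  shows "\<bar>interpolant f h N u\<bar> \<le> M"
proof -
  obtain x y l where xy: "x \<in> {0..N * h}" "y \<in> {0..N * h}" and l: "0 \<le> l" "l \<le> 1"
    and eq: "interpolant f h N u = (1 - l) * f x + l * f y"
    using interpolant_between[OF assms(1-4)] by metis
  have "\<bar>(1 - l) * f x\<bar> \<le> (1 - l) * M" "\<bar>l * f y\<bar> \<le> l * M"
    using l assms(5)[OF xy(1)] assms(5)[OF xy(2)] by (auto simp: abs_mult intro!: mult_left_mono)
  then show ?thesis unfolding eq by (simp add: algebra_simps)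
qed

lemma interpolant_close:
  fixes h u :: real
  assumes "0 < h" "0 < N" "0 \<le> u" "u \<le> N * h"
    and "\<And>x. x \<in> {0..N * h} \<Longrightarrow> \<bar>x - u\<bar> \<le> h \<Longrightarrow> \<bar>f x - f u\<bar> \<le> e"
  shows "\<bar>interpolant f h N u - f u\<bar> \<le> e"
proof -
  obtain x y l where xy: "x \<in> {0..N * h}" "y \<in> {0..N * h}" "\<bar>x - u\<bar> \<le> h" "\<bar>y - u\<bar> \<le> h"
    and l: "0 \<le> l" "l \<le> 1" and eq: "interpolant f h N u = (1 - l) * f x + l * f y"
    using interpolant_between[OF assms(1-4)] by metis
  have "\<bar>(1 - l) * (f x - f u)\<bar> \<le> (1 - l) * e" "\<bar>l * (f y - f u)\<bar> \<le> l * e"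
    using l assms(5) xy by (auto simp: abs_mult intro!: mult_left_mono)
  moreover have "interpolant f h N u - f u = (1 - l) * (f x - f u) + l * (f y - f u)"
    unfolding eq by (simp add: algebra_simps)
  ultimately show ?thesis by (simp add: algebra_simps)
qed

text \<open>Both end points are nodes, so the interpolants are exact there even if \<open>f\<close>
  jumps. Inside, continuity at \<open>u\<close> controls \<open>f\<close> on the shrinking
  cells.\<close>

lemma interpolant_tendsto:
  assumes c: "0 < c" and f: "continuous_on {0<..<c} f" and u: "u \<in> {0..c}"
  shows "(\<lambda>N. interpolant f (c / Suc N) (Suc N) u) \<longlonglongrightarrow> f u"
proof -
  have eq: "Suc N * (c / Suc N) = c" for N by simp
  consider "u = 0" | "u = c" | "u \<in> {0<..<c}" using u by fastforce
  then show ?thesis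
  proof cases
    case 1
    then show ?thesis using c by (simp add: interpolant_0 del: of_nat_Suc)
  next
    case 2
    have "interpolant f (c / Suc N) (Suc N) c = f c" for N
      using interpolant_beyond[of "c / Suc N" "Suc N" c f] c by (simp only: eq) simp
    then show ?thesis using 2 by simp
  next
    case 3
    show ?thesis
    proof (rule LIMSEQ_I)
      fix e :: real assume "0 < e"
      have "isCont f u" using f 3 by (simp add: continuous_on_eq_continuous_at)
      then obtain d where d: "0 < d" "\<And>x. \<bar>x - u\<bar> < d \<Longrightarrow> \<bar>f x - f u\<bar> < e / 2"
        using \<open>0 < e\<close> unfolding continuous_at_eps_delta dist_real_def by (meson half_gt_zero)
      have "(\<lambda>N. c / Suc N) \<longlonglongrightarrow> 0"
        by (rule tendsto_divide_0[OF tendsto_const filterlim_at_top_imp_at_infinity])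
           (rule filterlim_compose[OF filterlim_real_sequentially filterlim_Suc])
      from LIMSEQ_D[OF this d(1)] obtain N0 where N0: "\<And>N. N \<ge> N0 \<Longrightarrow> norm (c / Suc N - 0) < d"
        by blast
      have "\<bar>interpolant f (c / Suc N) (Suc N) u - f u\<bar> \<le> e / 2" if "N \<ge> N0" for N
      proof (rule interpolant_close)
        fix x assume "\<bar>x - u\<bar> \<le> c / Suc N"
        with N0[OF that] c show "\<bar>f x - f u\<bar> \<le> e / 2" using d(2)[of x] by simp
      qed (use c u in auto)
      then have "norm (interpolant f (c / Suc N) (Suc N) u - f u) < e" if "N \<ge> N0" for N
        using \<open>0 < e\<close> that by (fastforce simp del: of_nat_Suc)
      then show "\<exists>N0. \<forall>N\<ge>N0. norm (interpolant f (c / Suc N) (Suc N) u - f u) < e"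
        by blast
    qed
  qed
qed

lemma interpolant_continuous: "continuous_on S (interpolant f h N)"
  unfolding interpolant_def[abs_def] by (intro continuous_intros)

section \<open>Nonnegativity for interpolants of convex functions\<close>

lemma sin_pairing_interpolant:
  fixes h :: real
  shows "sin_pairing m n (interpolant f h N) = (\<Sum>k<N. (f (Suc k * h) - f (k * h)) / h *
     (sin_pairing m n (\<lambda>u. max 0 (u - k * h)) - sin_pairing m n (\<lambda>u. max 0 (u - Suc k * h))))"
proof (induction N)
  case (Suc N)
  let ?d = "(f (Suc N * h) - f (N * h)) / h"
  let ?p = "\<lambda>k u. max 0 (u - real k * h)"
  have p: "continuous_on UNIV (\<lambda>u. c * ?p k u)" for c :: real and k :: nat
    by (intro continuous_on_mult_left continuous_on_max continuous_on_diff continuous_on_const continuous_on_id)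
  have cont: "continuous_on UNIV (\<lambda>u. ?d * ?p N u + - ?d * ?p (Suc N) u)"
    by (rule continuous_on_add[OF p p])
  have "sin_pairing m n (interpolant f h (Suc N)) =
      sin_pairing m n (\<lambda>u. interpolant f h N u + (?d * ?p N u + - ?d * ?p (Suc N) u))"
    by (rule arg_cong[where f = "sin_pairing m n"], rule ext)
       (simp only: interpolant_Suc right_diff_distrib mult_minus_left add_uminus_conv_diff)
  also have "\<dots> = sin_pairing m n (interpolant f h N) +
      (?d * sin_pairing m n (?p N) + - ?d * sin_pairing m n (?p (Suc N)))"
    unfolding sin_pairing_add[OF interpolant_continuous cont] sin_pairing_add[OF p p] sin_pairing_scale ..
  finally show ?case
    by (simp only: Suc.IH sum.lessThan_Suc right_diff_distrib mult_minus_left add_uminus_conv_diff)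
qed (simp add: interpolant_def[abs_def] sin_pairing_const)

text \<open>Abel summation: the boundary terms vanish, leaving increments of \<open>d\<close> times
  values of \<open>g\<close>.\<close>

lemma sum_mono_mult_telescope_nonneg:
  fixes d g :: "nat \<Rightarrow> real"
  assumes "g 0 = 0" and "\<And>k. k \<le> N \<Longrightarrow> 0 \<le> g k" and "\<And>k. Suc k < N \<Longrightarrow> d k \<le> d (Suc k)"
    and "g N = 0"
  shows "0 \<le> (\<Sum>k<N. d k * (g k - g (Suc k)))"
proof (cases N)
  case (Suc N')
  \<comment> \<open>The lower bound is the boundary term of the partial summation; at the last index
    it is \<open>0\<close> because \<open>g N = 0\<close>.\<close>
  have "- d k * g (Suc k) \<le> (\<Sum>k<Suc k. d k * (g k - g (Suc k)))" if "k < N" for k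
    using that
  proof (induction k)
    case (Suc k)
    have "(d (Suc k) - d k) * g (Suc k) \<ge> 0"
      using assms Suc.prems by (intro mult_nonneg_nonneg) auto
    then show ?case using Suc by (simp add: algebra_simps)
  qed (simp add: assms(1))
  from this[of N'] show ?thesis using assms(4) Suc by simp
qed simp

text \<open>In the Abel summation \<open>d\<close> is the sequence of slopes, increasing by
  convexity, and \<open>g\<close> consists of values of the Peano kernel.\<close>

lemma sin_pairing_interpolant_nonneg:
  assumes m: "m > 0" and n: "n > 0" and f: "convex_on {0..4 * pi} f" and N: "N > 0"
  shows "0 \<le> sin_pairing m n (interpolant f (4 * pi / N) N)"
proof -
  define h where "h = 4 * pi / N"
  have h: "h > 0" "N * h = 4 * pi" using N by (auto simp: h_def)
  have le: "k * h \<le> 4 * pi" if "k \<le> N" for k :: nat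
    unfolding h(2)[symmetric] using that h(1) by (intro mult_right_mono) auto
  have G: "sin_pairing m n (\<lambda>u. max 0 (u - k * h)) = peano_kernel m n (min (k * h) (4 * pi - k * h))"
    if "k \<le> N" for k :: nat
    using sin_pairing_pos_part[OF m n, of "k * h"] le[OF that] h(1) by simp
  have "0 \<le> (\<Sum>k<N. (f (Suc k * h) - f (k * h)) / h *
     (sin_pairing m n (\<lambda>u. max 0 (u - k * h)) - sin_pairing m n (\<lambda>u. max 0 (u - Suc k * h))))"
  proof (rule sum_mono_mult_telescope_nonneg)
    show "0 \<le> sin_pairing m n (\<lambda>u. max 0 (u - k * h))" if "k \<le> N" for k :: nat
      unfolding G[OF that] using le[OF that] h(1) by (intro peano_kernel_nonneg[OF m n]) auto
    show "(f (Suc k * h) - f (k * h)) / h \<le> (f (Suc (Suc k) * h) - f (Suc k * h)) / h"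
      if "Suc k < N" for k
    proof -
      have in_I: "k * h \<in> {0..4 * pi}" "Suc (Suc k) * h \<in> {0..4 * pi}"
        using le[of k] le[of "Suc (Suc k)"] that h(1) by (auto simp del: of_nat_Suc)
      \<comment> \<open>Midpoint convexity at three consecutive nodes compares neighbouring
        slopes.\<close>
      have "f ((1 - 1 / 2) *\<^sub>R (k * h) + (1 / 2) *\<^sub>R (Suc (Suc k) * h)) \<le>
          (1 - 1 / 2) * f (k * h) + 1 / 2 * f (Suc (Suc k) * h)"
        by (rule convex_onD[OF f _ _ in_I]) auto
      moreover have "(1 - 1 / 2) *\<^sub>R (k * h) + (1 / 2) *\<^sub>R (Suc (Suc k) * h) = Suc k * h"
        by (simp add: field_simps)
      ultimately show ?thesis using h(1) by (intro divide_right_mono) auto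
    qed
    \<comment> \<open>For hinges at \<open>0\<close> and \<open>4 * pi\<close> the kernel is
      evaluated at a minimum equal to \<open>0\<close>.\<close>
    show "sin_pairing m n (\<lambda>u. max 0 (u - real 0 * h)) = 0" using G[of 0] by simp
    show "sin_pairing m n (\<lambda>u. max 0 (u - N * h)) = 0" using G[of N] h(2) by simp
  qed
  then show ?thesis
    unfolding sin_pairing_interpolant h_def[symmetric] .
qed

section \<open>Passage to the limit\<close>

text \<open>Dominated convergence is applied twice: \<open>M\<close> dominates the inner integrands,
  since \<open>s + t\<close> stays in \<open>[0, 4 * pi]\<close>, and the integral of
  \<open>M\<close> dominates the inner integrals.\<close>

lemma sin_pairing_tendsto:
  assumes cont: "\<And>k. continuous_on UNIV (g k)"
    and bound: "\<And>k u. u \<in> {0..4 * pi} \<Longrightarrow> \<bar>g k u\<bar> \<le> M"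
    and lim: "\<And>u. u \<in> {0..4 * pi} \<Longrightarrow> (\<lambda>k. g k u) \<longlonglongrightarrow> f u"
  shows "(\<lambda>k. sin_pairing m n (g k)) \<longlonglongrightarrow> sin_pairing m n f"
proof -
  let ?k = "\<lambda>f s t. f (s + t) * sin (real m * s) * sin (real n * t)"
  have le: "norm (?k (g k) s t) \<le> M" if "s \<in> {0..2 * pi}" "t \<in> {0..2 * pi}" for k s t
  proof -
    have "\<bar>g k (s + t)\<bar> * \<bar>sin (real m * s)\<bar> * \<bar>sin (real n * t)\<bar> \<le> M * 1 * 1"
      using that bound[of "s + t" k] by (intro mult_mono) auto
    then show ?thesis by (simp add: abs_mult)
  qed
  have inner: "(\<lambda>k. integral {0..2 * pi} (\<lambda>s. ?k (g k) s t)) \<longlonglongrightarrow> integral {0..2 * pi} (\<lambda>s. ?k f s t)"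
    if t: "t \<in> {0..2 * pi}" for t
  proof (rule dominated_convergence)
    show "(\<lambda>s. ?k (g k) s t) integrable_on {0..2 * pi}" for k
      by (rule sin_pairing_integrable[OF cont])
    show "(\<lambda>k. ?k (g k) s t) \<longlonglongrightarrow> ?k f s t" if "s \<in> {0..2 * pi}" for s
      using lim[of "s + t"] that t by (intro tendsto_intros) auto
  qed (use le t in \<open>auto intro: integrable_const_ivl\<close>)
  show ?thesis
    unfolding sin_pairing_def
  proof (rule dominated_convergence[OF _ _ _ inner])
    show "(\<lambda>t. integral {0..2 * pi} (\<lambda>s. ?k (g k) s t)) integrable_on {0..2 * pi}" for k
      by (rule sin_pairing_integrable[OF cont])
    show "norm (integral {0..2 * pi} (\<lambda>s. ?k (g k) s t)) \<le> integral {0..2 * pi} (\<lambda>_. M)"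
      if "t \<in> {0..2 * pi}" for k t
      by (rule integral_norm_bound_integral[OF sin_pairing_integrable(1)[OF cont] integrable_const_ivl le])
         (use that in auto)
  qed (rule integrable_const_ivl)
qed

theorem proposition1:
  fixes f :: "real \<Rightarrow> real" and m n :: nat
  assumes "mono_on {0..4*pi} f \<or> antimono_on {0..4*pi} f"
    and "convex_on {0..4*pi} f"
    and "m > 0" and "n > 0"
  shows "integral {0..2*pi} (\<lambda>t. integral {0..2*pi}
           (\<lambda>s. f (s + t) * sin (real m * s) * sin (real n * t))) \<ge> 0"
proof -
  let ?g = "\<lambda>N. interpolant f (4 * pi / Suc N) (Suc N)"
  \<comment> \<open>Convexity yields continuity on the open interval, as the convergence of the
    interpolants requires.\<close>
  have "continuous_on {0<..<4 * pi} f"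
    by (intro convex_on_continuous convex_on_subset[OF assms(2)]) auto
  then have lim: "(\<lambda>N. ?g N u) \<longlonglongrightarrow> f u" if "u \<in> {0..4 * pi}" for u
    using that by (intro interpolant_tendsto) auto
  \<comment> \<open>Monotonicity traps \<open>f\<close> between its end values, which gives a bound
    uniform in \<open>N\<close> for the interpolants.\<close>
  have "\<bar>f u\<bar> \<le> \<bar>f 0\<bar> + \<bar>f (4 * pi)\<bar>" if "u \<in> {0..4 * pi}" for u
  proof -
    have "(f 0 \<le> f u \<and> f u \<le> f (4 * pi)) \<or> (f (4 * pi) \<le> f u \<and> f u \<le> f 0)"
      using assms(1) that unfolding monotone_on_def by auto
    then show ?thesis by auto
  qed
  then have "\<bar>?g N u\<bar> \<le> \<bar>f 0\<bar> + \<bar>f (4 * pi)\<bar>" if "u \<in> {0..4 * pi}" for N u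
    using that by (intro interpolant_bounded) auto
  then have "(\<lambda>N. sin_pairing m n (?g N)) \<longlonglongrightarrow> sin_pairing m n f"
    using lim by (intro sin_pairing_tendsto interpolant_continuous) auto
  then have "0 \<le> sin_pairing m n f"
    using sin_pairing_interpolant_nonneg[OF assms(3,4,2)]
    by (intro LIMSEQ_le_const) (auto simp del: of_nat_Suc)
  then show ?thesis by (simp only: sin_pairing_def)
qed

end
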